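(* Let $X$ be a set and $R$ a solution on $X$. The following are equivalent: (1) $R$ is idempotent, i.e. $R^2=R$; (2) $R$ is commutative, i.e. $R^{12}R^{13}=R^{13}R^{12}$; (3) $R$ is cocommutative, i.e. $R^{13}R^{23}=R^{23}R^{13}$; (4) $R=R^f$ for some idempotent function $f=f^2:X\to X$, where $R^f(x,y)=(f(x),f(y))$ for all $x,y\in X$. In particular, if $X$ is a finite set with $|X|=n$, then the number of isomorphism classes of all idempotent solutions on $X$ is equal to the partition number $p(n)$, while the number of all idempotent solutions on $X$ is $\sum_{k=0}^n\binom{n}{k}k^{n-k}$.
   Context: All sets are non-empty. For a set $X$ let $\tau_X(x,y)=(y,x)$ be the flip map on $X\times X$. For a map $R:X\times X\to X\times X$ put, as maps $X^3\to X^3$, $R^{12}=R\times \mathrm{Id}_X$, $R^{23}=\mathrm{Id}_X\times R$, $R^{13}=(\mathrm{Id}_X\times\tau_X)\circ R^{12}\circ(\mathrm{Id}_X\times\tau_X)$. $R$ is called a solution on $X$ (of the set-theoretic Frobenius-Separability equation) if $R^{12}R^{23}=R^{23}R^{13}=R^{13}R^{12}$. An isomorphism of solutions $(X,R)\to(X',R')$ is a bijection $\sigma:X\to X'$ with $(\sigma\times\sigma)\circ R=R'\circ(\sigma\times\sigma)$. $p(n)$ is the number of partitions of the integer $n$. *)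

theory Defs
  imports Main "HOL-Library.FuncSet" "HOL-Library.Multiset"
begin

text \<open>
  A map on \<open>X \<times> X\<close> is a HOL function of which only the values on the carrier matter, so equalities
  between maps are stated pointwise on the carrier. The cube of \<open>X\<close> is the right-nested product
  \<open>X \<times> X \<times> X\<close>.
\<close>

definition R12 :: "('a \<times> 'a \<Rightarrow> 'a \<times> 'a) \<Rightarrow> 'a \<times> 'a \<times> 'a \<Rightarrow> 'a \<times> 'a \<times> 'a" where
  "R12 R = (\<lambda>(x, y, z). (fst (R (x, y)), snd (R (x, y)), z))"

definition R23 :: "('a \<times> 'a \<Rightarrow> 'a \<times> 'a) \<Rightarrow> 'a \<times> 'a \<times> 'a \<Rightarrow> 'a \<times> 'a \<times> 'a" where
  "R23 R = map_prod id R"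

definition R13 :: "('a \<times> 'a \<Rightarrow> 'a \<times> 'a) \<Rightarrow> 'a \<times> 'a \<times> 'a \<Rightarrow> 'a \<times> 'a \<times> 'a" where
  "R13 R = map_prod id prod.swap \<circ> R12 R \<circ> map_prod id prod.swap"

definition fs_solution :: "'a set \<Rightarrow> ('a \<times> 'a \<Rightarrow> 'a \<times> 'a) \<Rightarrow> bool" where
  "fs_solution X R \<longleftrightarrow> R \<in> X \<times> X \<rightarrow> X \<times> X \<and>
     (\<forall>t \<in> X \<times> X \<times> X. (R12 R \<circ> R23 R) t = (R23 R \<circ> R13 R) t \<and>
                         (R23 R \<circ> R13 R) t = (R13 R \<circ> R12 R) t)"

definition idempotent_map :: "'b set \<Rightarrow> ('b \<Rightarrow> 'b) \<Rightarrow> bool" where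
  "idempotent_map A g \<longleftrightarrow> g \<in> A \<rightarrow> A \<and> (\<forall>x \<in> A. (g \<circ> g) x = g x)"

definition commutative_map :: "'a set \<Rightarrow> ('a \<times> 'a \<Rightarrow> 'a \<times> 'a) \<Rightarrow> bool" where
  "commutative_map X R \<longleftrightarrow> (\<forall>t \<in> X \<times> X \<times> X. (R12 R \<circ> R13 R) t = (R13 R \<circ> R12 R) t)"

definition cocommutative_map :: "'a set \<Rightarrow> ('a \<times> 'a \<Rightarrow> 'a \<times> 'a) \<Rightarrow> bool" where
  "cocommutative_map X R \<longleftrightarrow> (\<forall>t \<in> X \<times> X \<times> X. (R13 R \<circ> R23 R) t = (R23 R \<circ> R13 R) t)"

definition Rf :: "('a \<Rightarrow> 'a) \<Rightarrow> 'a \<times> 'a \<Rightarrow> 'a \<times> 'a" where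
  "Rf f = (\<lambda>(x, y). (f x, f y))"

definition solution_iso ::
    "('a \<Rightarrow> 'b) \<Rightarrow> 'a set \<Rightarrow> ('a \<times> 'a \<Rightarrow> 'a \<times> 'a) \<Rightarrow> 'b set \<Rightarrow> ('b \<times> 'b \<Rightarrow> 'b \<times> 'b) \<Rightarrow> bool" where
  "solution_iso \<sigma> X R X' R' \<longleftrightarrow> bij_betw \<sigma> X X' \<and>
     (\<forall>p \<in> X \<times> X. (map_prod \<sigma> \<sigma> \<circ> R) p = (R' \<circ> map_prod \<sigma> \<sigma>) p)"

text \<open>
  For counting, each map on \<open>X \<times> X\<close> is represented by its unique extensional representative
  (\<open>undefined\<close> outside \<open>X \<times> X\<close>), so that distinct elements of this set are distinct maps.
\<close>

definition idempotent_solutions :: "'a set \<Rightarrow> ('a \<times> 'a \<Rightarrow> 'a \<times> 'a) set" where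
  "idempotent_solutions X =
     {R \<in> X \<times> X \<rightarrow>\<^sub>E X \<times> X. fs_solution X R \<and> idempotent_map (X \<times> X) R}"

definition iso_rel :: "'a set \<Rightarrow> (('a \<times> 'a \<Rightarrow> 'a \<times> 'a) \<times> ('a \<times> 'a \<Rightarrow> 'a \<times> 'a)) set" where
  "iso_rel X = {(R, R'). R \<in> idempotent_solutions X \<and> R' \<in> idempotent_solutions X \<and>
                         (\<exists>\<sigma>. solution_iso \<sigma> X R X R')}"

text \<open>A partition of \<open>n\<close> is the multiset of its (positive) parts.\<close>

definition partition_number :: "nat \<Rightarrow> nat" where
  "partition_number n = card {M :: nat multiset. 0 \<notin># M \<and> sum_mset M = n}"

end

theory Submission
  imports Defs "HOL-Combinatorics.Permutations"
begin

text \<open>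
  Write \<open>R (x, y) = (a x y, b x y)\<close>. Compared coordinate by coordinate, the Frobenius-separability
  equation says
  \<open>a x (a y z) = a x z = a (a x y) z\<close>, \<open>b x (a y z) = a y (b x z) = b x y\<close> and
  \<open>b y (b x z) = b y z = b (a x y) z\<close>.
  Each of idempotency, commutativity and cocommutativity, combined with these identities, forces
  \<open>a\<close> to ignore its second argument, \<open>b\<close> to ignore its first, and the two resulting unary maps to
  be the same function \<open>f\<close>; then \<open>a (a x y) z = a x z\<close> says that \<open>f\<close> is idempotent. Conversely
  \<open>Rf f\<close> with \<open>f\<close> idempotent visibly satisfies all the conditions.

  So the idempotent solutions on \<open>X\<close> correspond one to one to the idempotent self-maps of \<open>X\<close>
  (\<open>bij_betw_idempotent_solutions\<close>), and an isomorphism of solutions is a bijection conjugating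
  these self-maps. Let \<open>X\<close> be finite. An idempotent map with image \<open>Y\<close> is an arbitrary function from \<open>X - Y\<close> to \<open>Y\<close>
  extended by the identity on \<open>Y\<close>, so there are \<open>(card Y) ^ (card X - card Y)\<close> of them; summing
  over \<open>Y\<close> gives the second count. Up to conjugation, an idempotent map is a partition of \<open>X\<close> into
  blocks, its fibres, each with a distinguished point, its value. The multiset of the block sizes is
  a complete invariant because a bijection between blocks of equal size can be chosen to match the
  distinguished points (\<open>fibre_type_eq_imp_conjugate\<close>), and every partition of \<open>card X\<close> occurs as
  such a multiset (\<open>fibre_type_surj\<close>).
\<close>

section \<open>Conditions that force a solution to be diagonal\<close>

lemma Rf_apply [simp]: "Rf f (x, y) = (f x, f y)"
  by (simp add: Rf_def)

lemma R12_apply: "R12 R (x, y, z) = (fst (R (x, y)), snd (R (x, y)), z)"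
  by (simp add: R12_def)

lemma R23_apply: "R23 R (x, y, z) = (x, fst (R (y, z)), snd (R (y, z)))"
  by (simp add: R23_def)

lemma R13_apply: "R13 R (x, y, z) = (fst (R (x, z)), y, snd (R (x, z)))"
  by (simp add: R13_def R12_def)

lemmas leg_simps = o_apply R12_apply R23_apply R13_apply fst_conv snd_conv prod.inject

lemma fs_solution_closed:
  assumes "fs_solution X R" "x \<in> X" "y \<in> X"
  shows "fst (R (x, y)) \<in> X" "snd (R (x, y)) \<in> X"
  using assms unfolding fs_solution_def by (auto simp: Pi_iff mem_Times_iff)

lemma fs_solution_coordinates:
  assumes "fs_solution X R" "x \<in> X" "y \<in> X" "z \<in> X"
  defines "a \<equiv> \<lambda>u v. fst (R (u, v))" and "b \<equiv> \<lambda>u v. snd (R (u, v))"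
  shows "a x (a y z) = a x z" "a (a x y) z = a x z"
    "b x (a y z) = b x y" "a y (b x z) = b x y"
    "b y (b x z) = b y z" "b (a x y) z = b y z"
proof -
  have "(R12 R \<circ> R23 R) (x, y, z) = (R23 R \<circ> R13 R) (x, y, z)"
       "(R23 R \<circ> R13 R) (x, y, z) = (R13 R \<circ> R12 R) (x, y, z)"
    using assms(1-4) unfolding fs_solution_def by blast+
  note this[unfolded leg_simps]
  then show "a x (a y z) = a x z" "a (a x y) z = a x z"
    "b x (a y z) = b x y" "a y (b x z) = b x y"
    "b y (b x z) = b y z" "b (a x y) z = b y z"
    unfolding a_def b_def by metis+
qed

text \<open>
  Idempotency of \<open>f\<close> comes from the Frobenius-separability equation: with \<open>fst (R (x, y)) = f x\<close>,
  the coordinate identity \<open>a (a x y) z = a x z\<close> reads \<open>f (f x) = f x\<close>.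
\<close>

lemma diagonalI:
  assumes sol: "fs_solution X R"
    and a: "\<And>x y. x \<in> X \<Longrightarrow> y \<in> X \<Longrightarrow> fst (R (x, y)) = f x"
    and b: "\<And>x y. x \<in> X \<Longrightarrow> y \<in> X \<Longrightarrow> snd (R (x, y)) = f y"
  shows "\<exists>f. idempotent_map X f \<and> (\<forall>p \<in> X \<times> X. R p = Rf f p)"
proof (intro exI conjI)
  have closed: "f x \<in> X" if "x \<in> X" for x
    using fs_solution_closed(1)[OF sol that that] a[OF that that] by simp
  moreover have "f (f x) = f x" if "x \<in> X" for x
    using fs_solution_coordinates(2)[OF sol that that that] a that closed by simp
  ultimately show "idempotent_map X f"
    by (simp add: idempotent_map_def)
  show "\<forall>p \<in> X \<times> X. R p = Rf f p"
    using a b by (auto simp: prod_eq_iff Rf_def)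
qed

text \<open>
  With \<open>u = a x y\<close> and \<open>v = b x y\<close>, idempotency says \<open>a u v = u\<close> and \<open>b u v = v\<close>. The
  coordinate identities evaluate the left-hand sides differently:
  \<open>a (a x y) v = a x (b x y) = b x x\<close> and \<open>b (a x y) v = b y (b x y) = b y y\<close>. So \<open>f\<close> is the
  diagonal \<open>\<lambda>x. b x x\<close>.
\<close>

lemma idempotent_imp_diagonal:
  assumes sol: "fs_solution X R" and idem: "idempotent_map (X \<times> X) R"
  shows "\<exists>f. idempotent_map X f \<and> (\<forall>p \<in> X \<times> X. R p = Rf f p)"
proof (rule diagonalI[OF sol])
  fix x y assume xy: "x \<in> X" "y \<in> X"
  define u v where "u = fst (R (x, y))" and "v = snd (R (x, y))"
  have uv: "u \<in> X" "v \<in> X"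
    using fs_solution_closed[OF sol xy] by (simp_all add: u_def v_def)
  have "R (R (x, y)) = R (x, y)"
    using idem xy by (simp add: idempotent_map_def)
  then have fix_uv: "fst (R (u, v)) = u" "snd (R (u, v)) = v"
    by (simp_all add: u_def v_def)
  have "fst (R (u, v)) = snd (R (x, x))"
    using fs_solution_coordinates(2)[OF sol xy uv(2)] fs_solution_coordinates(4)[OF sol xy(1) xy(1) xy(2)]
    by (simp add: u_def v_def)
  with fix_uv show "fst (R (x, y)) = snd (R (x, x))" by (simp add: u_def)
  have "snd (R (u, v)) = snd (R (y, y))"
    using fs_solution_coordinates(6)[OF sol xy uv(2)] fs_solution_coordinates(5)[OF sol xy xy(2)]
    by (simp add: u_def v_def)
  with fix_uv show "snd (R (x, y)) = snd (R (y, y))" by (simp add: v_def)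
qed

text \<open>
  Commutativity turns the identities for \<open>a (a x y) z\<close> and \<open>b (a x z) y\<close> into \<open>a x y = a x z\<close> and
  \<open>b x y = b z y\<close>; then \<open>a y (b x z) = b x y\<close> identifies the two unary maps that remain.
\<close>

lemma commutative_imp_diagonal:
  assumes sol: "fs_solution X R" and comm: "commutative_map X R"
  shows "\<exists>f. idempotent_map X f \<and> (\<forall>p \<in> X \<times> X. R p = Rf f p)"
proof -
  define a b where "a u v = fst (R (u, v))" and "b u v = snd (R (u, v))" for u v
  note eqs = fs_solution_coordinates[OF sol, folded a_def b_def]
  note closed = fs_solution_closed[OF sol, folded a_def b_def]
  have comm_eqs: "a (a x z) y = a (a x y) z" "b (a x z) y = b x y"
    if "x \<in> X" "y \<in> X" "z \<in> X" for x y z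
  proof -
    have "(R12 R \<circ> R13 R) (x, y, z) = (R13 R \<circ> R12 R) (x, y, z)"
      using comm that unfolding commutative_map_def by blast
    from this[unfolded leg_simps, folded a_def b_def]
    show "a (a x z) y = a (a x y) z" "b (a x z) y = b x y"
      by blast+
  qed
  have a_const: "a x y = a x z" if "x \<in> X" "y \<in> X" "z \<in> X" for x y z
    using comm_eqs(1)[OF that] eqs(2) that by metis
  have b_const: "b x y = b z y" if "x \<in> X" "y \<in> X" "z \<in> X" for x y z
    using comm_eqs(2)[OF that] eqs(6)[OF that(1,3,2)] by simp
  have ab: "a x y = b y x" if "x \<in> X" "y \<in> X" for x y
    using eqs(4)[OF that(2,1,2)] a_const[OF that(1) that(2) closed(2)[OF that(2,2)]] by simp
  show ?thesis
  proof (rule diagonalI[OF sol])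
    fix x y assume xy: "x \<in> X" "y \<in> X"
    show "fst (R (x, y)) = a x x"
      using a_const[OF xy xy(1)] by (simp add: a_def)
    show "snd (R (x, y)) = a y y"
      using b_const[OF xy xy(2)] ab[OF xy(2,2)] by (simp add: b_def)
  qed
qed

lemma cocommutative_imp_diagonal:
  assumes sol: "fs_solution X R" and cocomm: "cocommutative_map X R"
  shows "\<exists>f. idempotent_map X f \<and> (\<forall>p \<in> X \<times> X. R p = Rf f p)"
proof -
  define a b where "a u v = fst (R (u, v))" and "b u v = snd (R (u, v))" for u v
  note eqs = fs_solution_coordinates[OF sol, folded a_def b_def]
  have cocomm_eq: "a x (b y z) = a x z" if "x \<in> X" "y \<in> X" "z \<in> X" for x y z
  proof -
    have "(R13 R \<circ> R23 R) (x, y, z) = (R23 R \<circ> R13 R) (x, y, z)"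
      using cocomm that unfolding cocommutative_map_def by blast
    from this[unfolded leg_simps, folded a_def b_def]
    show "a x (b y z) = a x z"
      by blast
  qed
  \<comment> \<open>One side does not mention \<open>y\<close> and the other does not mention \<open>z\<close>, so both depend on \<open>x\<close> alone.\<close>
  have ab: "a x z = b y x" if "x \<in> X" "y \<in> X" "z \<in> X" for x y z
    using cocomm_eq[OF that] eqs(4)[OF that(2,1,3)] by simp
  show ?thesis
  proof (rule diagonalI[OF sol])
    fix x y assume xy: "x \<in> X" "y \<in> X"
    show "fst (R (x, y)) = a x x"
      using ab[OF xy(1,1,1)] ab[OF xy(1,1,2)] by (simp add: a_def)
    show "snd (R (x, y)) = a y y"
      using ab[OF xy(2,1,2)] by (simp add: b_def)
  qed
qed

lemma diagonal_imp:
  assumes f: "idempotent_map X f" and R: "\<forall>p \<in> X \<times> X. R p = Rf f p"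
  shows "fs_solution X R" "idempotent_map (X \<times> X) R" "commutative_map X R" "cocommutative_map X R"
proof -
  have [simp]: "f x \<in> X" "f (f x) = f x" if "x \<in> X" for x
    using f that by (auto simp: idempotent_map_def)
  have [simp]: "R (x, y) = (f x, f y)" if "x \<in> X" "y \<in> X" for x y
    using R that by simp
  show "fs_solution X R" "idempotent_map (X \<times> X) R" "commutative_map X R" "cocommutative_map X R"
    by (auto simp: fs_solution_def idempotent_map_def commutative_map_def cocommutative_map_def
        R12_apply R23_apply R13_apply)
qed

theorem diagonal_characterisations:
  assumes "fs_solution X R"
  defines "diagonal \<equiv> \<exists>f. idempotent_map X f \<and> (\<forall>p \<in> X \<times> X. R p = Rf f p)"
  shows "idempotent_map (X \<times> X) R \<longleftrightarrow> diagonal"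
    and "commutative_map X R \<longleftrightarrow> diagonal"
    and "cocommutative_map X R \<longleftrightarrow> diagonal"
  unfolding diagonal_def
  using idempotent_imp_diagonal commutative_imp_diagonal cocommutative_imp_diagonal
    diagonal_imp assms(1) by metis+

section \<open>Idempotent solutions and idempotent self-maps\<close>

definition idempotent_selfmaps :: "'a set \<Rightarrow> ('a \<Rightarrow> 'a) set" where
  "idempotent_selfmaps X = {f \<in> X \<rightarrow>\<^sub>E X. idempotent_map X f}"

text \<open>
  Surjectivity is the fact that idempotent solutions are diagonal; injectivity holds because \<open>f\<close>
  can be read off the first coordinate on the diagonal of \<open>X \<times> X\<close>.
\<close>

lemma bij_betw_idempotent_solutions:
  "bij_betw (\<lambda>f. restrict (Rf f) (X \<times> X)) (idempotent_selfmaps X) (idempotent_solutions X)"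
proof (rule bij_betw_imageI)
  show "inj_on (\<lambda>f. restrict (Rf f) (X \<times> X)) (idempotent_selfmaps X)"
  proof (rule inj_onI)
    fix f g assume fg: "f \<in> idempotent_selfmaps X" "g \<in> idempotent_selfmaps X"
      and eq: "restrict (Rf f) (X \<times> X) = restrict (Rf g) (X \<times> X)"
    have "f x = g x" if "x \<in> X" for x
      using fun_cong[OF eq, of "(x, x)"] that by simp
    then show "f = g"
      using fg by (auto simp: idempotent_selfmaps_def intro: PiE_ext)
  qed
  show "(\<lambda>f. restrict (Rf f) (X \<times> X)) ` idempotent_selfmaps X = idempotent_solutions X"
  proof (intro equalityI subsetI)
    fix R assume "R \<in> (\<lambda>f. restrict (Rf f) (X \<times> X)) ` idempotent_selfmaps X"
    then obtain f where f: "idempotent_map X f" and R: "R = restrict (Rf f) (X \<times> X)"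
      by (auto simp: idempotent_selfmaps_def)
    have "\<forall>p \<in> X \<times> X. R p = Rf f p" by (simp add: R)
    moreover have "R \<in> extensional (X \<times> X)" by (simp add: R)
    ultimately show "R \<in> idempotent_solutions X"
      using diagonal_imp(1,2)[OF f, of R]
      unfolding idempotent_solutions_def idempotent_map_def PiE_def by blast
  next
    fix R assume R: "R \<in> idempotent_solutions X"
    then obtain f where f: "idempotent_map X f" and Rf: "\<forall>p \<in> X \<times> X. R p = Rf f p"
      using idempotent_imp_diagonal unfolding idempotent_solutions_def by blast
    have "restrict f X \<in> idempotent_selfmaps X"
      using f by (auto simp: idempotent_selfmaps_def idempotent_map_def)
    moreover have "R = restrict (Rf (restrict f X)) (X \<times> X)"
    proof
      fix p
      show "R p = restrict (Rf (restrict f X)) (X \<times> X) p"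
      proof (cases "p \<in> X \<times> X")
        case True then show ?thesis using Rf by auto
      next
        case False
        have "R \<in> extensional (X \<times> X)"
          using R by (simp add: idempotent_solutions_def PiE_def)
        from extensional_arb[OF this False] show ?thesis
          by (simp only: restrict_apply False if_False)
      qed
    qed
    ultimately show "R \<in> (\<lambda>f. restrict (Rf f) (X \<times> X)) ` idempotent_selfmaps X"
      by blast
  qed
qed

section \<open>Counting idempotent self-maps\<close>

text \<open>
  An idempotent map fixes its image \<open>Y\<close> pointwise and sends everything else anywhere into \<open>Y\<close>, so
  the idempotent maps with image \<open>Y\<close> form a product of sets that are singletons over \<open>Y\<close> and equal
  to \<open>Y\<close> over the complement.
\<close>

lemma idempotent_selfmaps_with_image:
  assumes "Y \<subseteq> X"
  shows "{f \<in> idempotent_selfmaps X. f ` X = Y} = (\<Pi>\<^sub>E x\<in>X. if x \<in> Y then {x} else Y)"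
proof (intro equalityI subsetI)
  fix f assume "f \<in> {f \<in> idempotent_selfmaps X. f ` X = Y}"
  then show "f \<in> (\<Pi>\<^sub>E x\<in>X. if x \<in> Y then {x} else Y)"
    by (auto simp: idempotent_selfmaps_def idempotent_map_def PiE_iff)
next
  fix f assume f: "f \<in> (\<Pi>\<^sub>E x\<in>X. if x \<in> Y then {x} else Y)"
  have on_Y: "f x = x" if "x \<in> Y" for x
    using PiE_mem[OF f, of x] that assms by auto
  have into_Y: "f x \<in> Y" if "x \<in> X" for x
    using PiE_mem[OF f that] by (auto split: if_splits)
  have "f ` X = Y"
    using on_Y into_Y assms by force
  moreover have "f \<in> X \<rightarrow>\<^sub>E X"
    using f into_Y assms by (auto simp: PiE_iff)
  moreover have "idempotent_map X f"
    using on_Y into_Y assms by (auto simp: idempotent_map_def)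
  ultimately show "f \<in> {f \<in> idempotent_selfmaps X. f ` X = Y}"
    by (simp add: idempotent_selfmaps_def)
qed

lemma card_idempotent_selfmaps_with_image:
  assumes "finite X" "Y \<subseteq> X"
  shows "card {f \<in> idempotent_selfmaps X. f ` X = Y} = card Y ^ (card X - card Y)"
proof -
  have "card {f \<in> idempotent_selfmaps X. f ` X = Y} = (\<Prod>x\<in>X. card (if x \<in> Y then {x} else Y))"
    using assms by (simp add: idempotent_selfmaps_with_image card_PiE)
  also have "\<dots> = (\<Prod>x\<in>X - Y. card Y)"
    using assms by (intro prod.mono_neutral_cong_right) auto
  also have "\<dots> = card Y ^ (card X - card Y)"
    using assms by (simp add: card_Diff_subset finite_subset)
  finally show ?thesis .
qed

lemma finite_idempotent_selfmaps: "finite X \<Longrightarrow> finite (idempotent_selfmaps X)"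
  unfolding idempotent_selfmaps_def
  by (rule finite_subset[of _ "X \<rightarrow>\<^sub>E X"]) (auto intro: finite_PiE)

theorem card_idempotent_selfmaps:
  assumes "finite X"
  shows "card (idempotent_selfmaps X) = (\<Sum>k = 0..card X. (card X choose k) * k ^ (card X - k))"
proof -
  let ?n = "card X"
  have "card (idempotent_selfmaps X) = (\<Sum>f\<in>idempotent_selfmaps X. 1)"
    by simp
  also have "\<dots> = (\<Sum>Y\<in>Pow X. card {f \<in> idempotent_selfmaps X. f ` X = Y})"
    using assms finite_idempotent_selfmaps[OF assms]
    by (subst sum.group[of _ "Pow X" "\<lambda>f. f ` X", symmetric])
      (auto simp: idempotent_selfmaps_def)
  also have "\<dots> = (\<Sum>Y\<in>Pow X. card Y ^ (?n - card Y))"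
    using assms by (intro sum.cong) (simp_all add: card_idempotent_selfmaps_with_image)
  also have "\<dots> = (\<Sum>k\<in>{0..?n}. \<Sum>Y\<in>{Y \<in> Pow X. card Y = k}. card Y ^ (?n - card Y))"
    using assms by (intro sum.group[symmetric]) (auto intro: card_mono)
  also have "\<dots> = (\<Sum>k = 0..?n. (?n choose k) * k ^ (?n - k))"
    using assms by (intro sum.cong) (simp_all add: n_subsets)
  finally show ?thesis .
qed

section \<open>Fibre sizes classify idempotent self-maps up to conjugation\<close>

abbreviation fibre :: "'a set \<Rightarrow> ('a \<Rightarrow> 'b) \<Rightarrow> 'b \<Rightarrow> 'a set" where
  "fibre X f y \<equiv> {x \<in> X. f x = y}"

definition fibre_type :: "'a set \<Rightarrow> ('a \<Rightarrow> 'b) \<Rightarrow> nat multiset" where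
  "fibre_type X f = image_mset (\<lambda>y. card (fibre X f y)) (mset_set (f ` X))"

lemma fibre_type_cong:
  assumes "\<And>x. x \<in> X \<Longrightarrow> f x = g x"
  shows "fibre_type X f = fibre_type X g"
proof -
  have "f ` X = g ` X" "\<And>y. fibre X f y = fibre X g y"
    using assms by (auto simp: image_def)
  then show ?thesis by (simp add: fibre_type_def)
qed

lemma fibre_type_partition:
  assumes "finite X"
  shows "0 \<notin># fibre_type X f" "sum_mset (fibre_type X f) = card X"
proof -
  show "0 \<notin># fibre_type X f"
    using assms by (auto simp: fibre_type_def)
  have "card X = (\<Sum>y\<in>f ` X. card (fibre X f y))"
    using sum.image_gen[OF assms, of "\<lambda>_. 1::nat" f] by simp
  then show "sum_mset (fibre_type X f) = card X"
    by (simp add: fibre_type_def sum_unfold_sum_mset)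
qed

lemma conjugate_imp_fibre_type_eq:
  assumes \<sigma>: "bij_betw \<sigma> X X'" and conj: "\<And>x. x \<in> X \<Longrightarrow> \<sigma> (f x) = f' (\<sigma> x)" and f: "f ` X \<subseteq> X"
  shows "fibre_type X f = fibre_type X' f'"
proof -
  have inj: "inj_on \<sigma> X" and X': "X' = \<sigma> ` X"
    using \<sigma> by (auto simp: bij_betw_def)
  have image: "f' ` X' = \<sigma> ` f ` X"
    using conj by (auto simp: X' image_image)
  have "card (fibre X' f' (\<sigma> y)) = card (fibre X f y)" if "y \<in> f ` X" for y
  proof -
    have "\<sigma> (f x) = \<sigma> y \<longleftrightarrow> f x = y" if "x \<in> X" for x
      using inj_onD[OF inj, of "f x" y] that \<open>y \<in> f ` X\<close> f by blast
    then have "fibre X' f' (\<sigma> y) = \<sigma> ` fibre X f y"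
      by (auto simp: X' conj[symmetric])
    then show ?thesis
      using inj by (simp add: card_image inj_on_subset)
  qed
  then have "image_mset (\<lambda>y. card (fibre X' f' (\<sigma> y))) (mset_set (f ` X)) = fibre_type X f"
    unfolding fibre_type_def by (cases "finite (f ` X)") (auto intro: image_mset_cong)
  then show ?thesis
    by (simp add: fibre_type_def[of X'] image multiset.map_comp comp_def
        image_mset_mset_set[OF inj_on_subset[OF inj f], symmetric])
qed

text \<open>
  Pulling \<open>d\<close> back along an arbitrary bijection from \<open>A\<close> to \<open>B\<close> reduces the claim to two functions
  on the single set \<open>A\<close> with the same multiset of values, which differ by a permutation of \<open>A\<close>.
\<close>

lemma image_mset_eq_imp_bij_betw:
  assumes fin: "finite A" "finite B"
    and eq: "image_mset c (mset_set A) = image_mset d (mset_set B)"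
  obtains \<beta> where "bij_betw \<beta> A B" "\<And>x. x \<in> A \<Longrightarrow> d (\<beta> x) = c x"
proof -
  have "card A = card B"
    using arg_cong[OF eq, of size] by simp
  then obtain q where q: "bij_betw q A B"
    using fin finite_same_card_bij by blast
  then have "mset_set B = image_mset q (mset_set A)"
    using image_mset_mset_set[of q A] by (simp add: bij_betw_def)
  then have "image_mset c (mset_set A) = image_mset (d \<circ> q) (mset_set A)"
    using eq by (simp add: multiset.map_comp)
  then obtain p where p: "p permutes A" "\<forall>x\<in>A. c x = (d \<circ> q) (p x)"
    using image_mset_eq_implies_permutes[OF fin(1)] by metis
  show thesis
  proof
    show "bij_betw (q \<circ> p) A B"
      using permutes_imp_bij[OF p(1)] q by (rule bij_betw_trans)
  qed (use p in simp)
qed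

lemma pointed_bij_betw:
  assumes "finite A" "finite B" "card A = card B" "a \<in> A" "b \<in> B"
  obtains h where "bij_betw h A B" "h a = b"
proof -
  have "card (A - {a}) = card (B - {b})"
    using assms by simp
  then obtain g where g: "bij_betw g (A - {a}) (B - {b})"
    using assms finite_same_card_bij[of "A - {a}" "B - {b}"] by blast
  have "bij_betw (g(a := b)) (insert a (A - {a})) (insert b (B - {b}))"
    using g unfolding bij_betw_def inj_on_def by (auto simp: image_iff)
  then show thesis
    using that[of "g(a := b)"] assms by (simp add: insert_absorb)
qed

text \<open>
  Equal fibre types give a bijection between the two images that preserves fibre sizes. It extends
  to the whole set by bijections from fibre to fibre; these must be chosen to send the value of \<open>f\<close> on
  a fibre, which lies in that fibre by idempotency, to the corresponding value of \<open>f'\<close>, as that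
  is what makes the glued bijection commute with the maps.
\<close>

lemma fibre_type_eq_imp_conjugate:
  assumes fin: "finite X" "finite X'" and f: "idempotent_map X f" and f': "idempotent_map X' f'"
    and eq: "fibre_type X f = fibre_type X' f'"
  obtains \<sigma> where "bij_betw \<sigma> X X'" "\<And>x. x \<in> X \<Longrightarrow> \<sigma> (f x) = f' (\<sigma> x)"
proof -
  have fX: "f x \<in> X" "f (f x) = f x" if "x \<in> X" for x
    using f that by (auto simp: idempotent_map_def)
  have fX': "f' x \<in> X'" "f' (f' x) = f' x" if "x \<in> X'" for x
    using f' that by (auto simp: idempotent_map_def)
  obtain \<beta> where \<beta>: "bij_betw \<beta> (f ` X) (f' ` X')"
    and card_\<beta>: "\<And>y. y \<in> f ` X \<Longrightarrow> card (fibre X' f' (\<beta> y)) = card (fibre X f y)"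
    using image_mset_eq_imp_bij_betw[OF _ _ eq[unfolded fibre_type_def]] fin by blast
  have "\<exists>h. bij_betw h (fibre X f y) (fibre X' f' (\<beta> y)) \<and> h y = \<beta> y" if y: "y \<in> f ` X" for y
  proof -
    have "\<beta> y \<in> f' ` X'"
      using \<beta> y by (rule bij_betw_apply)
    then have "y \<in> fibre X f y" "\<beta> y \<in> fibre X' f' (\<beta> y)"
      using y fX fX' by auto
    then show ?thesis
      using pointed_bij_betw[of "fibre X f y" "fibre X' f' (\<beta> y)" y "\<beta> y"] card_\<beta>[OF y] fin by auto
  qed
  then have "\<forall>y\<in>f ` X. \<exists>h. bij_betw h (fibre X f y) (fibre X' f' (\<beta> y)) \<and> h y = \<beta> y"
    by (rule ballI)
  from bchoice[OF this] obtain h where h_both: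
    "\<forall>y\<in>f ` X. bij_betw (h y) (fibre X f y) (fibre X' f' (\<beta> y)) \<and> h y y = \<beta> y" ..
  then have h: "bij_betw (h y) (fibre X f y) (fibre X' f' (\<beta> y))"
    and h_point: "h y y = \<beta> y" if "y \<in> f ` X" for y
    using bspec[OF h_both that] by simp_all
  define \<sigma> where "\<sigma> x = h (f x) x" for x
  have \<sigma>_fibre: "\<sigma> x \<in> X'" "f' (\<sigma> x) = \<beta> (f x)" if "x \<in> X" for x
  proof -
    have "x \<in> fibre X f (f x)" using that by simp
    with h[OF imageI[OF that]] have "h (f x) x \<in> fibre X' f' (\<beta> (f x))"
      by (rule bij_betw_apply)
    then show "\<sigma> x \<in> X'" "f' (\<sigma> x) = \<beta> (f x)" by (simp_all add: \<sigma>_def)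
  qed
  have inj: "inj_on \<sigma> X"
  proof (rule inj_onI)
    fix x y assume xy: "x \<in> X" "y \<in> X" and eq: "\<sigma> x = \<sigma> y"
    then have "\<beta> (f x) = \<beta> (f y)"
      using \<sigma>_fibre by metis
    then have "f x = f y"
      using \<beta> xy by (auto simp: bij_betw_def dest: inj_onD)
    with eq xy show "x = y"
      using inj_onD[OF bij_betw_imp_inj_on[OF h[OF imageI[OF xy(1)]]], of x y]
      by (simp add: \<sigma>_def)
  qed
  \<comment> \<open>The common fibre type sums to both cardinalities, so injectivity of \<open>\<sigma>\<close> suffices.\<close>
  have "card X = card X'"
    using fibre_type_partition(2)[OF fin(1), of f] fibre_type_partition(2)[OF fin(2), of f'] eq by simp
  then have "\<sigma> ` X = X'"
    using inj \<sigma>_fibre fin by (intro card_subset_eq) (auto simp: card_image)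
  with inj have "bij_betw \<sigma> X X'"
    by (simp add: bij_betw_def)
  moreover have "\<sigma> (f x) = f' (\<sigma> x)" if "x \<in> X" for x
    using that fX \<sigma>_fibre h_point by (simp add: \<sigma>_def)
  ultimately show thesis
    by (rule that)
qed

text \<open>
  Each part \<open>k\<close> is realised by collapsing a block of \<open>k\<close> elements onto one of its points; such a
  point exists because parts are positive.
\<close>

lemma fibre_type_surj:
  assumes "finite X" "0 \<notin># M" "sum_mset M = card X"
  shows "\<exists>f. idempotent_map X f \<and> fibre_type X f = M"
  using assms
proof (induction M arbitrary: X)
  case empty
  then show ?case
    by (auto simp: fibre_type_def idempotent_map_def)
next
  case (add k M)
  obtain Y where Y: "Y \<subseteq> X" "card Y = k"
    using add.prems obtain_subset_with_card_n[of k X] by auto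
  then have finY: "finite Y" and "Y \<noteq> {}"
    using add.prems finite_subset by auto
  then obtain a where a: "a \<in> Y" by blast
  have "sum_mset M = card (X - Y)"
    using add.prems Y finY by (simp add: card_Diff_subset)
  then obtain g where g: "idempotent_map (X - Y) g" and gM: "fibre_type (X - Y) g = M"
    using add.IH[of "X - Y"] add.prems by auto
  have gX: "g x \<in> X" "g x \<notin> Y" "g (g x) = g x" if "x \<in> X" "x \<notin> Y" for x
    using g that by (auto simp: idempotent_map_def)
  define f where "f x = (if x \<in> Y then a else g x)" for x
  have "idempotent_map X f"
    using gX a Y by (auto simp: idempotent_map_def f_def)
  moreover have "fibre_type X f = add_mset k M"
  proof -
    have image: "f ` X = insert a (g ` (X - Y))"
      using a Y by (force simp: f_def)
    have new: "a \<notin> g ` (X - Y)"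
      using a gX by auto
    have "fibre X f a = Y"
      using a Y gX by (auto simp: f_def)
    moreover have "fibre X f y = fibre (X - Y) g y" if "y \<in> g ` (X - Y)" for y
      using that new by (auto simp: f_def)
    then have "image_mset (\<lambda>y. card (fibre X f y)) (mset_set (g ` (X - Y))) = M"
      unfolding gM[symmetric] fibre_type_def using add.prems(1) by (intro image_mset_cong) simp
    ultimately show ?thesis
      using new add.prems(1) Y(2) by (simp add: fibre_type_def image)
  qed
  ultimately show ?case by blast
qed

section \<open>Counting isomorphism classes\<close>

lemma card_quotient_complete_invariant:
  assumes "\<And>x y. (x, y) \<in> r \<longleftrightarrow> x \<in> A \<and> y \<in> A \<and> h x = h y"
  shows "card (A // r) = card (h ` A)"
proof -
  have "r `` {x} = {y \<in> A. h y = h x}" if "x \<in> A" for x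
    using assms that by auto
  then have "A // r = (\<lambda>v. {y \<in> A. h y = v}) ` h ` A"
    by (auto simp: quotient_def)
  moreover have "inj_on (\<lambda>v. {y \<in> A. h y = v}) (h ` A)"
    by (auto simp: inj_on_def)
  ultimately show ?thesis
    by (simp add: card_image)
qed

text \<open>
  The underlying self-map of a diagonal solution is recovered as \<open>\<lambda>x. fst (R (x, x))\<close>, so its
  fibre type can be written as a function of \<open>R\<close>.
\<close>

lemma iso_rel_iff_fibre_type_eq:
  assumes fin: "finite X"
  defines "invariant \<equiv> \<lambda>R. fibre_type X (\<lambda>x. fst (R (x, x)))"
  shows "(R, R') \<in> iso_rel X \<longleftrightarrow>
    R \<in> idempotent_solutions X \<and> R' \<in> idempotent_solutions X \<and> invariant R = invariant R'"
proof -
  have "(\<exists>\<sigma>. solution_iso \<sigma> X R X R') \<longleftrightarrow> invariant R = invariant R'"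
    if sols: "R \<in> idempotent_solutions X" "R' \<in> idempotent_solutions X"
  proof -
    obtain f where f: "idempotent_map X f" "\<forall>p \<in> X \<times> X. R p = Rf f p"
      using sols(1) idempotent_imp_diagonal unfolding idempotent_solutions_def by blast
    obtain f' where f': "idempotent_map X f'" "\<forall>p \<in> X \<times> X. R' p = Rf f' p"
      using sols(2) idempotent_imp_diagonal unfolding idempotent_solutions_def by blast
    have inv: "invariant R = fibre_type X f" "invariant R' = fibre_type X f'"
      unfolding invariant_def using f f' by (auto intro!: fibre_type_cong)
    have iso: "solution_iso \<sigma> X R X R' \<longleftrightarrow> bij_betw \<sigma> X X \<and> (\<forall>x\<in>X. \<sigma> (f x) = f' (\<sigma> x))" for \<sigma>
    proof (cases "bij_betw \<sigma> X X")
      case True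
      have "(map_prod \<sigma> \<sigma> \<circ> R) (x, y) = (R' \<circ> map_prod \<sigma> \<sigma>) (x, y) \<longleftrightarrow>
          \<sigma> (f x) = f' (\<sigma> x) \<and> \<sigma> (f y) = f' (\<sigma> y)" if "x \<in> X" "y \<in> X" for x y
        using that f(2) f'(2) bij_betw_apply[OF True] by simp
      then show ?thesis
        using True unfolding solution_iso_def by blast
    qed (simp add: solution_iso_def)
    have "f ` X \<subseteq> X"
      using f by (auto simp: idempotent_map_def)
    then have "fibre_type X f = fibre_type X f'" if "solution_iso \<sigma> X R X R'" for \<sigma>
      using conjugate_imp_fibre_type_eq[of \<sigma> X X f f'] that unfolding iso by blast
    moreover have "\<exists>\<sigma>. solution_iso \<sigma> X R X R'" if eq: "fibre_type X f = fibre_type X f'"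
    proof -
      obtain \<sigma> where "bij_betw \<sigma> X X" "\<And>x. x \<in> X \<Longrightarrow> \<sigma> (f x) = f' (\<sigma> x)"
        by (rule fibre_type_eq_imp_conjugate[OF fin fin f(1) f'(1) eq]) (rule that)
      then show ?thesis
        unfolding iso by (intro exI[of _ \<sigma>] conjI ballI)
    qed
    ultimately show ?thesis
      unfolding inv by blast
  qed
  then show ?thesis
    by (auto simp: iso_rel_def)
qed

lemma invariants_eq_partitions:
  assumes fin: "finite X"
  shows "(\<lambda>R. fibre_type X (\<lambda>x. fst (R (x, x)))) ` idempotent_solutions X =
    {M. 0 \<notin># M \<and> sum_mset M = card X}"
proof (intro equalityI subsetI)
  fix M assume "M \<in> (\<lambda>R. fibre_type X (\<lambda>x. fst (R (x, x)))) ` idempotent_solutions X"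
  then show "M \<in> {M. 0 \<notin># M \<and> sum_mset M = card X}"
    using fibre_type_partition[OF fin] by auto
next
  fix M :: "nat multiset" assume "M \<in> {M. 0 \<notin># M \<and> sum_mset M = card X}"
  then obtain f where f: "idempotent_map X f" "fibre_type X f = M"
    using fibre_type_surj[OF fin] by blast
  have "restrict f X \<in> idempotent_selfmaps X"
    using f by (auto simp: idempotent_selfmaps_def idempotent_map_def)
  then have "restrict (Rf (restrict f X)) (X \<times> X) \<in> idempotent_solutions X"
    by (rule bij_betw_apply[OF bij_betw_idempotent_solutions])
  moreover have "fibre_type X (\<lambda>x. fst (restrict (Rf (restrict f X)) (X \<times> X) (x, x))) = M"
    unfolding f(2)[symmetric] by (rule fibre_type_cong) simp
  ultimately show "M \<in> (\<lambda>R. fibre_type X (\<lambda>x. fst (R (x, x)))) ` idempotent_solutions X"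
    by blast
qed

theorem corollary2p16:
  fixes X :: "'a set"
  assumes "X \<noteq> {}"
  shows "(\<forall>R. fs_solution X R \<longrightarrow>
            (idempotent_map (X \<times> X) R \<longleftrightarrow> commutative_map X R) \<and>
            (commutative_map X R \<longleftrightarrow> cocommutative_map X R) \<and>
            (cocommutative_map X R \<longleftrightarrow>
               (\<exists>f. idempotent_map X f \<and> (\<forall>p \<in> X \<times> X. R p = Rf f p)))) \<and>
         (\<forall>n. finite X \<and> card X = n \<longrightarrow>
            card (idempotent_solutions X // iso_rel X) = partition_number n \<and>
            card (idempotent_solutions X) = (\<Sum>k = 0..n. (n choose k) * k ^ (n - k)))"
proof (intro conjI allI impI)
  fix R assume sol: "fs_solution X R"
  show "idempotent_map (X \<times> X) R \<longleftrightarrow> commutative_map X R"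
    "commutative_map X R \<longleftrightarrow> cocommutative_map X R"
    "cocommutative_map X R \<longleftrightarrow> (\<exists>f. idempotent_map X f \<and> (\<forall>p \<in> X \<times> X. R p = Rf f p))"
    by (simp_all only: diagonal_characterisations[OF sol])
next
  fix n assume "finite X \<and> card X = n"
  then have fin: "finite X" and card_X: "card X = n" by simp_all
  show "card (idempotent_solutions X // iso_rel X) = partition_number n"
    unfolding card_quotient_complete_invariant[OF iso_rel_iff_fibre_type_eq[OF fin]]
      invariants_eq_partitions[OF fin] card_X partition_number_def ..
  show "card (idempotent_solutions X) = (\<Sum>k = 0..n. (n choose k) * k ^ (n - k))"
    using card_idempotent_selfmaps[OF fin]
      bij_betw_same_card[OF bij_betw_idempotent_solutions, of X]
    unfolding card_X by simp
qed

end
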